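(* Let $n\ge k\ge 3$ be integers, $m=\lceil (n-k)/2\rceil$, and let $\mathcal{F}$ be a family of subsets of $[n]$ containing neither a copy of $Y_k$ nor a copy of $Y'_k$ on consecutive levels. Let $\sigma$ be any cyclic permutation of $[n]$, and for $0\le i\le n$ let $x_i$ be the number of intervals of size $i$ along $\sigma$ that belong to $\mathcal{F}$. Then \[ |\{\emptyset,[n]\} \cap \mathcal{F}|\cdot n + \sum_{i = 1}^{n-1}\binom{n}{i}x_i \le n\cdot\big(2^{n} - S(n,k,m)\big) + n-1. \]
   Context: For integers $k\ge 2$ and $r$, $S(n,k,r) = \sum_{0\le i\le n,\ i \equiv r \pmod k}\binom{n}{i}$. A family $\mathcal{F}$ of subsets of $[n]$ contains a copy of $Y_k$ on consecutive levels if it contains $k+1$ distinct sets $F_1, F_2, G_1, \ldots, G_{k-1}$ with $G_1\subset \cdots \subset G_{k-1} \subset F_1$, $G_{k-1}\subset F_2$, and $|F_1| = |F_2| = |G_{k-1}|+1 = \cdots = |G_1|+k-1$; it contains a copy of $Y'_k$ on consecutive levels if it contains $k+1$ distinct sets with $G_1\supset\cdots\supset G_{k-1}\supset F_1$, $G_{k-1}\supset F_2$, and $|F_1|=|F_2|=|G_{k-1}|-1=\cdots=|G_1|-(k-1)$. A cyclic permutation $\sigma$ of $[n]$ is a cyclic ordering $a_1,a_2,\ldots,a_n,a_1$ of the elements of $[n]$; an interval along $\sigma$ is a set $\{a_{t+1},a_{t+2},\ldots,a_{t+s}\}$ (indices modulo $n$) for some $t$ and $0\le s\le n$. Thus the intervals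 of size $0$ and $n$ are $\emptyset$ and $[n]$, and for $1\le s\le n-1$ there are exactly $n$ intervals of size $s$. *)

theory Defs
  imports Complex_Main "HOL-Number_Theory.Cong" "HOL-Combinatorics.Multiset_Permutations"
begin

definition S :: "nat \<Rightarrow> nat \<Rightarrow> int \<Rightarrow> nat" where
  "S n k r = (\<Sum>i | i \<le> n \<and> [int i = r] (mod int k). n choose i)"

text \<open>
  The sets \<open>G\<^sub>1, \<dots>, G\<^sub>k\<^sub>-\<^sub>1\<close> are the values of \<open>G\<close> on \<open>{1..k-1}\<close>; its other values are irrelevant.
  The cardinality conditions are stated additively, so that no truncated subtraction of
  cardinalities occurs. They are meant for families of finite sets.
\<close>

definition contains_Y :: "nat \<Rightarrow> 'a set set \<Rightarrow> bool" where
  "contains_Y k \<F> \<longleftrightarrow>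
     (\<exists>F1 F2 G. F1 \<in> \<F> \<and> F2 \<in> \<F> \<and> (\<forall>i\<in>{1..k-1}. G i \<in> \<F>) \<and>
        F1 \<noteq> F2 \<and> inj_on G {1..k-1} \<and> F1 \<notin> G ` {1..k-1} \<and> F2 \<notin> G ` {1..k-1} \<and>
        (\<forall>i\<in>{1..<k-1}. G i \<subset> G (Suc i)) \<and> G (k-1) \<subset> F1 \<and> G (k-1) \<subset> F2 \<and>
        card F1 = card F2 \<and> (\<forall>i\<in>{1..k-1}. card F1 = card (G i) + (k - i)))"

definition contains_Y' :: "nat \<Rightarrow> 'a set set \<Rightarrow> bool" where
  "contains_Y' k \<F> \<longleftrightarrow>
     (\<exists>F1 F2 G. F1 \<in> \<F> \<and> F2 \<in> \<F> \<and> (\<forall>i\<in>{1..k-1}. G i \<in> \<F>) \<and>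
        F1 \<noteq> F2 \<and> inj_on G {1..k-1} \<and> F1 \<notin> G ` {1..k-1} \<and> F2 \<notin> G ` {1..k-1} \<and>
        (\<forall>i\<in>{1..<k-1}. G (Suc i) \<subset> G i) \<and> F1 \<subset> G (k-1) \<and> F2 \<subset> G (k-1) \<and>
        card F1 = card F2 \<and> (\<forall>i\<in>{1..k-1}. card F1 + (k - i) = card (G i)))"

text \<open>
  A cyclic ordering \<open>a\<^sub>1, \<dots>, a\<^sub>n, a\<^sub>1\<close> is given by any list \<open>[a\<^sub>1, \<dots>, a\<^sub>n]\<close> listing it once around,
  i.e. an element of \<^term>\<open>permutations_of_set {1..n}\<close>; the choice of the starting point does not
  affect which sets are intervals. The list is indexed from 0, so \<open>a\<^sub>t\<^sub>+\<^sub>1\<close> is \<open>\<sigma> ! (t mod n)\<close>.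
\<close>

definition intervals :: "'a list \<Rightarrow> 'a set set" where
  "intervals \<sigma> =
     {{\<sigma> ! ((t + j) mod length \<sigma>) | j. j < s} | t s. s \<le> length \<sigma>}"

definition interval_count :: "nat set set \<Rightarrow> nat list \<Rightarrow> nat \<Rightarrow> nat" where
  "interval_count \<F> \<sigma> i = card {I \<in> intervals \<sigma>. card I = i \<and> I \<in> \<F>}"

end

theory Submission
  imports Defs
begin

text \<open>
  Index the intervals by starting point \<open>t\<close> and size \<open>s\<close>, taking \<open>n\<close> copies of the empty and of the
  full set, and let \<open>z s\<close> be the number of starting points whose interval of size \<open>s\<close> is missing
  from the family; the claim is a lower bound for the sum of \<open>(n choose s) * z s\<close>.
  Forbidding \<open>Y\<^sub>k\<close> and \<open>Y'\<^sub>k\<close> forces any \<open>k\<close> consecutive levels strictly between \<open>0\<close> and \<open>n\<close>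
  to miss at least \<open>n\<close> intervals in total, and the first and the last \<open>k\<close> levels to miss at least
  \<open>n / 2\<close> each.

  Lay the missing intervals out on a line, level by level, and split them by position modulo \<open>n\<close>.
  The levels met by a residue class form a set that hits every window of \<open>k\<close> consecutive levels,
  with possible exceptions at the two ends, which are repaired by adding level \<open>0\<close> or \<open>n\<close> at cost
  \<open>1\<close>. A set hitting all windows has binomial weight at least \<open>S n k m\<close>. The repairs cost at most
  \<open>n\<close> altogether; if they cost exactly \<open>n\<close>, then level \<open>k\<close> is missing entirely, and some residue
  class exceeds the minimal weight.
\<close>

section \<open>Binomial sums over residue classes\<close>

lemma S_eq_sum_if: "S n k r = (\<Sum>i\<le>n. if [int i = r] (mod int k) then n choose i else 0)"
  unfolding S_def by (subst sum.inter_filter [symmetric]) (auto intro!: sum.cong)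

lemma S_cong: "[r = s] (mod int k) \<Longrightarrow> S n k r = S n k s"
  unfolding S_def by (metis cong_sym cong_trans)

lemma S_Suc: "S (Suc n) k r = S n k r + S n k (r - 1)"
proof -
  let ?f = "\<lambda>r n i. if [int i = r] (mod int k) then n choose i else 0"
  have shift: "[int (Suc i) = r] (mod int k) \<longleftrightarrow> [int i = r - 1] (mod int k)" for i
    by (simp add: cong_iff_dvd_diff algebra_simps)
  have "S (Suc n) k r = ?f r (Suc n) 0 + (\<Sum>i\<le>n. ?f r (Suc n) (Suc i))"
    unfolding S_eq_sum_if by (rule sum.atMost_Suc_shift)
  also have "(\<Sum>i\<le>n. ?f r (Suc n) (Suc i)) = (\<Sum>i\<le>n. ?f r n (Suc i)) + S n k (r - 1)"
    unfolding S_eq_sum_if sum.distrib [symmetric] shift by (intro sum.cong) auto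
  also have "?f r (Suc n) 0 + ((\<Sum>i\<le>n. ?f r n (Suc i)) + S n k (r - 1)) =
      (\<Sum>i\<le>Suc n. ?f r n i) + S n k (r - 1)"
    by (simp add: sum.atMost_Suc_shift del: sum.atMost_Suc)
  also have "(\<Sum>i\<le>Suc n. ?f r n i) = S n k r"
    by (simp add: S_eq_sum_if)
  finally show ?thesis .
qed

lemma S_reflect: "S n k (int n - r) = S n k r"
  unfolding S_def
proof (rule sum.reindex_bij_witness [of _ "\<lambda>i. n - i" "\<lambda>i. n - i"], goal_cases)
  case (2 i)
  then show ?case by (auto simp: cong_iff_dvd_diff of_nat_diff dvd_diff_commute algebra_simps)
next
  case (4 i)
  then show ?case
    by (auto simp: cong_iff_dvd_diff of_nat_diff algebra_simps)
next
  case (5 i)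
  then show ?case using binomial_symmetric [of i n] by simp
qed auto

text \<open>By Pascal's rule the inequality for \<open>Suc n\<close> reduces to
  \<open>S n k (r + 1) \<le> S n k (r - 1)\<close>. Inside the range this takes two uses of the
  induction hypothesis; at the extremes \<open>2 * r = n\<close> and \<open>2 * r = n + k\<close>
  reflection makes both sides equal.\<close>

lemma S_antimono_step:
  assumes "2 \<le> k" and "int n \<le> 2 * r + 1" and "2 * r + 1 \<le> int n + int k"
  shows "S n k (r + 1) \<le> S n k r"
  using assms(2,3)
proof (induction n arbitrary: r)
  case 0
  then have "0 < r + 1" "r + 1 < int k" using assms(1) by auto
  then have "\<not> int k dvd r + 1"
    by (rule zdvd_not_zless)
  then have "\<not> [0 = r + 1] (mod int k)"
    by (metis cong_0_iff cong_sym)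
  then show ?case by (simp add: S_eq_sum_if)
next
  case (Suc n)
  have "S n k (r + 1) \<le> S n k (r - 1)"
  proof -
    consider "2 * r = int n" | "2 * r = int n + int k" | "int n \<le> 2 * r - 1" "2 * r + 1 \<le> int n + int k"
      using Suc.prems by linarith
    then show ?thesis
    proof cases
      case 1
      then have "int n - (r + 1) = r - 1" by simp
      then show ?thesis using S_reflect [of n k "r + 1"] by simp
    next
      case 2
      then have "int n - (r + 1) = r - 1 - int k" by simp
      moreover have "S n k (r - 1 - int k) = S n k (r - 1)"
        by (rule S_cong) (simp add: cong_iff_dvd_diff)
      ultimately show ?thesis using S_reflect [of n k "r + 1"] by (metis order_refl)
    next
      case 3
      then show ?thesis using Suc.IH [of r] Suc.IH [of "r - 1"] by simp
    qed
  qed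
  then show ?case by (simp add: S_Suc)
qed

lemma S_antimono:
  assumes "2 \<le> k" and "int n \<le> 2 * r + 1" and "r \<le> s" and "2 * s \<le> int n + int k + 1"
  shows "S n k s \<le> S n k r"
  using assms(3,4)
proof (induction s rule: int_ge_induct)
  case (step s)
  then show ?case using S_antimono_step [of k n s] assms(1,2) by force
qed simp

text \<open>Modulo \<open>k\<close>, the residue \<open>m\<close> is farthest from the middle
  \<open>n / 2\<close>. Either \<open>r\<close> or its reflection \<open>n - r\<close> lies in the
  range where the sums decrease towards \<open>m + k\<close>, which has the same residue as
  \<open>m\<close>.\<close>

lemma S_minimal:
  assumes "2 \<le> k" and "int n \<le> 2 * m + int k" and "2 * m + int k \<le> int n + 1"
    and "m < r" and "r < m + int k"
  shows "S n k m \<le> S n k r"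
proof -
  have m: "S n k (m + int k) = S n k m"
    by (rule S_cong) (simp add: cong_iff_dvd_diff)
  show ?thesis
  proof (cases "int n \<le> 2 * r + 1")
    case True
    then show ?thesis using S_antimono [of k n r "m + int k"] assms m by simp
  next
    case False
    then show ?thesis
      using S_antimono [of k n "int n - r" "m + int k"] assms m by (simp add: S_reflect)
  qed
qed

section \<open>Partial sums over a residue class\<close>

fun residue_sum :: "nat \<Rightarrow> nat \<Rightarrow> nat \<Rightarrow> nat" where
  "residue_sum n k i = (n choose i) + (if 0 < k \<and> k \<le> i then residue_sum n k (i - k) else 0)"

declare residue_sum.simps [simp del]

lemma residue_sum_eq:
  assumes "0 < k"
  shows "residue_sum n k i = (\<Sum>j | j \<le> i \<and> [j = i] (mod k). n choose j)"
proof (induction i rule: less_induct)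
  case (less i)
  show ?case
  proof (cases "k \<le> i")
    case True
    have "{j. j \<le> i \<and> [j = i] (mod k)} = insert i {j. j \<le> i - k \<and> [j = i - k] (mod k)}"
      (is "?L = ?R")
    proof -
      have sub: "[j = i - k] (mod k) \<longleftrightarrow> [j = i] (mod k)" for j
        using True by (metis cong_add_rcancel_nat cong_def le_add_diff_inverse2 mod_add_self2)
      have "j \<le> i - k" if "j \<le> i" "[j = i] (mod k)" "j \<noteq> i" for j
      proof -
        have "k dvd i - j" using that by (metis cong_altdef_nat cong_sym)
        then have "k \<le> i - j" using that by (intro dvd_imp_le) auto
        then show ?thesis using that by simp
      qed
      then show ?thesis unfolding sub using assms by auto
    qed
    moreover have "i \<notin> {j. j \<le> i - k \<and> [j = i - k] (mod k)}" using assms True by auto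
    ultimately show ?thesis
      using True assms less.IH [of "i - k"] by (subst residue_sum.simps) simp
  next
    case False
    then have "{j. j \<le> i \<and> [j = i] (mod k)} = {i}" by (auto simp: cong_def)
    then show ?thesis using False by (subst residue_sum.simps) simp
  qed
qed

text \<open>The terms above \<open>i\<close> start at \<open>i + k\<close>; reflecting
  \<open>j\<close> to \<open>n - j\<close> turns them into a partial sum ending at
  \<open>n - i - k\<close>. Both halves then obey the same recursion.\<close>

lemma S_eq_residue_sum:
  assumes "0 < k" and "i \<le> n"
  shows "S n k (int i) = residue_sum n k i + (if i + k \<le> n then residue_sum n k (n - i - k) else 0)"
proof -
  let ?A = "{j. j \<le> i \<and> [j = i] (mod k)}"
  let ?B = "{j. i < j \<and> j \<le> n \<and> [j = i] (mod k)}"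
  have step: "i + k \<le> j" if "i < j" "[j = i] (mod k)" for j
  proof -
    have "k dvd j - i" using that by (simp add: cong_altdef_nat)
    then have "k \<le> j - i" using that by (intro dvd_imp_le) auto
    then show ?thesis using that by simp
  qed
  have "S n k (int i) = (\<Sum>j\<in>?A \<union> ?B. n choose j)"
    unfolding S_def using assms(2) by (intro sum.cong) (auto simp: cong_int_iff)
  also have "\<dots> = residue_sum n k i + (\<Sum>j\<in>?B. n choose j)"
    using assms(1) by (subst sum.union_disjoint) (auto simp: residue_sum_eq)
  also have "(\<Sum>j\<in>?B. n choose j) = (if i + k \<le> n then residue_sum n k (n - i - k) else 0)"
  proof (cases "i + k \<le> n")
    case True
    have refl: "[n - j = n - i - k] (mod k) \<longleftrightarrow> [j = i] (mod k)" if "j \<le> n" for j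
    proof -
      have "[n - j = n - i - k] (mod k) \<longleftrightarrow> int k dvd (int i + int k - int j)"
        using True that by (simp add: cong_int_iff [symmetric] cong_iff_dvd_diff of_nat_diff algebra_simps)
      also have "int i + int k - int j = (int i - int j) + int k" by simp
      also have "int k dvd (int i - int j) + int k \<longleftrightarrow> int k dvd int j - int i"
        by (simp add: dvd_diff_commute)
      finally show ?thesis by (simp add: cong_int_iff [symmetric] cong_iff_dvd_diff)
    qed
    have "(\<Sum>j\<in>?B. n choose j) = (\<Sum>j | j \<le> n - i - k \<and> [j = n - i - k] (mod k). n choose j)"
    proof (rule sum.reindex_bij_witness [of _ "\<lambda>j. n - j" "\<lambda>j. n - j"], goal_cases)
      case (2 j)
      then show ?case using refl [of j] step [of j] by auto
    next
      case (4 j)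
      then show ?case using refl [of "n - j"] True assms(1) by auto
    next
      case (5 j)
      then show ?case using binomial_symmetric [of j n] by simp
    qed auto
    then show ?thesis using True assms(1) by (simp add: residue_sum_eq)
  next
    case False
    have "\<not> (i < j \<and> j \<le> n \<and> [j = i] (mod k))" for j
      using step [of j] False by auto
    then show ?thesis using False by simp
  qed
  finally show ?thesis .
qed

lemma residue_sum_mono:
  assumes "i \<le> j" and "2 * j \<le> n"
  shows "residue_sum n k i \<le> residue_sum n k j"
  using assms
proof (induction j arbitrary: i rule: less_induct)
  case (less j)
  have "n choose i \<le> n choose j" using less.prems by (intro binomial_mono) auto
  moreover have "residue_sum n k (i - k) \<le> residue_sum n k (j - k)" if "0 < k" "k \<le> i"
    using less.IH [of "j - k" "i - k"] less.prems that by auto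
  ultimately show ?case
    using less.prems by (subst (1 2) residue_sum.simps) auto
qed

section \<open>Binomial weight of sets that hit every window\<close>

definition hits_windows :: "nat \<Rightarrow> nat \<Rightarrow> nat set \<Rightarrow> bool" where
  "hits_windows n k H \<longleftrightarrow> (\<forall>a. a + k \<le> Suc n \<longrightarrow> H \<inter> {a..<a + k} \<noteq> {})"

text \<open>The window just below an element \<open>h\<close> of \<open>H\<close> contains another
  element of \<open>H\<close>, so by induction the weight of \<open>H\<close> up to \<open>h\<close>
  is at least \<open>C h\<close>. In the last window \<open>C\<close> has reached its full value
  \<open>S n k m\<close>.\<close>

lemma hits_windows_weight:
  assumes k: "2 \<le> k" "k \<le> n" and m: "n \<le> 2 * m + k" "2 * m + k \<le> n + 1"
    and H: "H \<subseteq> {..n}" "hits_windows n k H"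
  shows "S n k (int m) \<le> (\<Sum>h\<in>H. n choose h)"
proof -
  txt \<open>\<open>C\<close> is the cumulative form of an optimal fractional packing of windows (linear programming
    duality): it is monotone and grows by at most \<open>n choose h\<close> between \<open>h - k\<close> and \<open>h\<close>.\<close>
  define C :: "nat \<Rightarrow> int" where
    "C i = (if i \<le> m then int (residue_sum n k i)
            else int (S n k (int m)) - (if i + k \<le> n then int (residue_sum n k (n - i - k)) else 0))" for i
  \<comment> \<open>The two branches of \<open>C\<close> agree at \<open>m\<close>, so the second
    formula is available from \<open>m\<close> on.\<close>
  have Sm: "int (S n k (int m)) = int (residue_sum n k m) + (if m + k \<le> n then int (residue_sum n k (n - m - k)) else 0)"
    using k m by (subst S_eq_residue_sum) auto
  have C_mono: "C i \<le> C j" if "i \<le> j" for i j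
  proof -
    have upper: "C i \<le> C j" if "m \<le> i" "i \<le> j" for i j
    proof -
      have C': "C i = int (S n k (int m)) - (if i + k \<le> n then int (residue_sum n k (n - i - k)) else 0)"
        if "m \<le> i" for i
        using that Sm by (auto simp: C_def le_less)
      have "residue_sum n k (n - j - k) \<le> residue_sum n k (n - i - k)" if "j + k \<le> n"
        using that \<open>i \<le> j\<close> \<open>m \<le> i\<close> m by (intro residue_sum_mono) auto
      then show ?thesis using that by (subst (1 2) C') auto
    qed
    have lower: "C i \<le> C j" if "j \<le> m" "i \<le> j" for i j
      using that residue_sum_mono [of i j n k] m k by (auto simp: C_def)
    show ?thesis
      using that upper [of m j] upper [of i j] lower [of j i] lower [of m i] by (meson linear order_trans)
  qed
  \<comment> \<open>For \<open>h \<le> m\<close> and for \<open>m + k \<le> h\<close> the recursion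
    of \<open>residue_sum\<close> gives equality. In between, \<open>C h\<close> and
    \<open>C (h - k)\<close> come from different branches, and the claim amounts to
    \<open>S n k m \<le> S n k h\<close>, the minimality of \<open>m\<close>.\<close>
  have C_step: "C h \<le> int (n choose h) + (if k \<le> h then C (h - k) else 0)" if "h \<le> n" for h
  proof -
    consider "h \<le> m" | "m < h" "h < m + k" | "m + k \<le> h" by linarith
    then show ?thesis
    proof cases
      case 1
      then show ?thesis using k by (auto simp: C_def residue_sum.simps [of n k h])
    next
      case 2
      have "int (S n k (int m)) \<le> int (S n k (int h))"
        using S_minimal [of k n "int m" "int h"] k m 2 by simp
      then have "int (S n k (int m)) \<le>
          int (residue_sum n k h) + (if h + k \<le> n then int (residue_sum n k (n - h - k)) else 0)"
        using k that by (subst (asm) (2) S_eq_residue_sum) auto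
      then show ?thesis using 2 k by (auto simp: C_def residue_sum.simps [of n k h])
    next
      case 3
      have "C (h - k) = int (S n k (int m)) - int (residue_sum n k (n - h))"
        using 3 that Sm by (auto simp: C_def not_less le_less)
      moreover have "residue_sum n k (n - h) = (n choose h) + (if h + k \<le> n then residue_sum n k (n - h - k) else 0)"
        using k that binomial_symmetric [of h n] by (subst residue_sum.simps) auto
      ultimately show ?thesis using 3 k by (auto simp: C_def)
    qed
  qed
  have fin: "finite H" using H(1) finite_subset by blast
  have "C h \<le> (\<Sum>g\<in>H \<inter> {..h}. int (n choose g))" if "h \<in> H" for h
    using that
  proof (induction h rule: less_induct)
    case (less h)
    have hn: "h \<le> n" using less.prems H(1) by auto
    have split: "(\<Sum>g\<in>H \<inter> {..h}. int (n choose g)) =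
        int (n choose h) + (\<Sum>g\<in>H \<inter> {..<h}. int (n choose g))"
    proof -
      have "H \<inter> {..h} = insert h (H \<inter> {..<h})" using less.prems by auto
      then show ?thesis using fin by simp
    qed
    have "(if k \<le> h then C (h - k) else 0) \<le> (\<Sum>g\<in>H \<inter> {..<h}. int (n choose g))"
    proof (cases "k \<le> h")
      case True
      then have "H \<inter> {h - k..<h - k + k} \<noteq> {}"
        using H(2) [unfolded hits_windows_def, rule_format, of "h - k"] hn by auto
      then obtain g where g: "g \<in> H" "h - k \<le> g" "g < h" using True by auto
      have "C (h - k) \<le> C g" using g by (intro C_mono)
      also have "\<dots> \<le> (\<Sum>g\<in>H \<inter> {..g}. int (n choose g))" using less.IH g by simp
      also have "\<dots> \<le> (\<Sum>g\<in>H \<inter> {..<h}. int (n choose g))"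
        using g fin by (intro sum_mono2) auto
      finally show ?thesis using True by simp
    qed (simp add: sum_nonneg)
    then show ?case using C_step [OF hn] split by simp
  qed
  moreover obtain h where h: "h \<in> H" "n < h + k"
  proof -
    have "H \<inter> {Suc n - k..<Suc n - k + k} \<noteq> {}"
      using H(2) [unfolded hits_windows_def, rule_format, of "Suc n - k"] k by auto
    then show thesis using that by fastforce
  qed
  moreover have "C h = int (S n k (int m))"
    using h Sm m k C_def by (cases "h = m") (auto simp: C_def)
  ultimately have "int (S n k (int m)) \<le> (\<Sum>g\<in>H \<inter> {..h}. int (n choose g))" by metis
  also have "\<dots> \<le> (\<Sum>g\<in>H. int (n choose g))" using fin by (intro sum_mono2) auto
  finally show ?thesis by (metis of_nat_le_iff of_nat_sum)
qed

section \<open>Rounding fractional hitting sets\<close>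

lemma card_mod_image_ge:
  fixes n :: nat
  assumes "0 < n"
  shows "min n l \<le> card ((\<lambda>x. x mod n) ` {a..<a + l})"
proof -
  have "inj_on (\<lambda>x. x mod n) {a..<a + min n l}"
  proof (rule linorder_inj_onI)
    fix x y
    assume "x < y" and xy: "x \<in> {a..<a + min n l}" "y \<in> {a..<a + min n l}"
    then have "0 < y - x" "y - x < n" by auto
    then have "\<not> n dvd y - x" by (rule nat_dvd_not_less)
    then show "x mod n \<noteq> y mod n"
      using \<open>x < y\<close> mod_eq_dvd_iff_nat [of x y n] by fastforce
  qed auto
  then have "min n l = card ((\<lambda>x. x mod n) ` {a..<a + min n l})"
    by (simp add: card_image)
  also have "\<dots> \<le> card ((\<lambda>x. x mod n) ` {a..<a + l})"
    by (intro card_mono image_mono) auto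
  finally show ?thesis .
qed

text \<open>Level \<open>i\<close> occupies a segment of length \<open>z i\<close> following the
  segments of the lower levels. A uniform choice of \<open>\<theta>\<close> below \<open>n\<close>
  is systematic sampling: it rounds the fractional set with weights \<open>z i / n\<close> to a set
  of levels.\<close>

definition level_set :: "nat \<Rightarrow> (nat \<Rightarrow> nat) \<Rightarrow> nat \<Rightarrow> nat set" where
  "level_set n z \<theta> = {i. i \<le> n \<and> \<theta> \<in> (\<lambda>x. x mod n) ` {sum z {..<i}..<sum z {..<Suc i}}}"

lemma card_level_set:
  "card {\<theta> \<in> {..<n}. i \<in> level_set n z \<theta>} \<le> z i"
proof -
  have "card {\<theta> \<in> {..<n}. i \<in> level_set n z \<theta>} \<le>
      card ((\<lambda>x. x mod n) ` {sum z {..<i}..<sum z {..<Suc i}})"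
    by (rule card_mono) (auto simp: level_set_def)
  also have "\<dots> \<le> card {sum z {..<i}..<sum z {..<Suc i}}"
    by (rule card_image_le) simp
  finally show ?thesis by simp
qed

text \<open>The segments of consecutive levels join into a single segment, and a segment of length
  \<open>l\<close> covers at least \<open>min n l\<close> residues modulo \<open>n\<close>.\<close>

lemma card_level_set_misses:
  assumes "0 < n" and "a + l \<le> Suc n"
  shows "card {\<theta> \<in> {..<n}. level_set n z \<theta> \<inter> {a..<a + l} = {}} \<le> n - sum z {a..<a + l}"
proof -
  define Z where "Z i = sum z {..<i}" for i
  let ?I = "(\<lambda>x. x mod n) ` {Z a..<Z (a + l)}"
  have Z_Suc: "Z (Suc i) = Z i + z i" for i
    by (simp add: Z_def)
  have Z_mono: "Z a \<le> Z (a + l)" for l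
    by (induction l) (auto simp: Z_Suc)
  have "(\<Union>i\<in>{a..<a + l}. {Z i..<Z (Suc i)}) = {Z a..<Z (a + l)}"
  proof (induction l)
    case (Suc l)
    have "(\<Union>i\<in>{a..<a + Suc l}. {Z i..<Z (Suc i)}) =
        {Z a..<Z (a + l)} \<union> {Z (a + l)..<Z (Suc (a + l))}"
      by (simp add: atLeastLessThanSuc Suc Un_commute)
    also have "\<dots> = {Z a..<Z (a + Suc l)}"
      using Z_mono [of l] by (subst ivl_disj_un_two) (auto simp: Z_Suc)
    finally show ?case .
  qed simp
  then have I: "?I = (\<Union>i\<in>{a..<a + l}. (\<lambda>x. x mod n) ` {Z i..<Z (Suc i)})"
    by (metis image_UN)
  have level: "i \<in> level_set n z \<theta> \<longleftrightarrow> i \<le> n \<and> \<theta> \<in> (\<lambda>x. x mod n) ` {Z i..<Z (Suc i)}" for i \<theta>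
    by (simp only: level_set_def Z_def mem_Collect_eq)
  have "level_set n z \<theta> \<inter> {a..<a + l} = {} \<longleftrightarrow> \<theta> \<notin> ?I" for \<theta>
    unfolding I disjoint_iff level UN_iff using assms(2)
    by (meson atLeastLessThan_iff less_Suc_eq_le less_le_trans)
  then have "{\<theta> \<in> {..<n}. level_set n z \<theta> \<inter> {a..<a + l} = {}} = {..<n} - ?I"
    by auto
  moreover have "?I \<subseteq> {..<n}"
    using assms(1) by auto
  ultimately have "card {\<theta> \<in> {..<n}. level_set n z \<theta> \<inter> {a..<a + l} = {}} = n - card ?I"
    by (simp add: card_Diff_subset)
  moreover have "Z (a + l) = Z a + sum z {a..<a + l}"
    by (simp add: Z_def sum.atLeastLessThan_concat lessThan_atLeast0)
  ultimately show ?thesis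
    using card_mod_image_ge [OF assms(1), of "sum z {a..<a + l}" "Z a"] by simp
qed

text \<open>Replacing all elements below \<open>k\<close> by \<open>0\<close> keeps every window
  hit: \<open>0\<close> meets the first one, \<open>k\<close> meets those starting in
  \<open>1..k\<close>, and later ones are untouched. This strictly lowers the weight, since some
  \<open>e\<close> with \<open>0 < e < k\<close> and \<open>n choose e\<close> at least 2 is
  removed.\<close>

lemma weight_gain:
  assumes k: "2 \<le> k" "k \<le> n" and m: "n \<le> 2 * m + k" "2 * m + k \<le> n + 1"
    and H: "H \<subseteq> {..n}" "hits_windows n k H"
    and e: "0 \<notin> H" "k \<in> H"
  shows "S n k (int m) < (\<Sum>h\<in>H. n choose h)"
proof -
  have fin: "finite H" using H(1) finite_subset by blast
  have "H \<inter> {0..<k} \<noteq> {}"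
    using H(2) [unfolded hits_windows_def, rule_format, of 0] k by simp
  then obtain e where eH: "e \<in> H" "e < k" by auto
  then have "0 < e" using e(1) by (cases e) auto
  let ?K = "H - {..<k}"
  have "hits_windows n k (insert 0 ?K)"
    unfolding hits_windows_def
  proof (intro allI impI)
    fix a
    assume a: "a + k \<le> Suc n"
    consider "a = 0" | "0 < a" "a \<le> k" | "k < a" by linarith
    then show "insert 0 ?K \<inter> {a..<a + k} \<noteq> {}"
    proof cases
      case 3
      moreover obtain g where "g \<in> H" "g \<in> {a..<a + k}"
        using H(2) [unfolded hits_windows_def, rule_format, OF a] by blast
      ultimately show ?thesis by auto
    qed (use k e in auto)
  qed
  then have "S n k (int m) \<le> (\<Sum>h\<in>insert 0 ?K. n choose h)"
    using H(1) by (intro hits_windows_weight k m) auto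
  also have "\<dots> = 1 + (\<Sum>h\<in>?K. n choose h)"
    using fin k by (subst sum.insert) auto
  also have "1 < n choose e"
  proof -
    obtain n' e' where ne: "n = Suc n'" "e = Suc e'"
      using \<open>0 < e\<close> k by (metis Suc_pred less_le_trans pos2)
    then have "0 < n' choose e'" "0 < n' choose Suc e'"
      using eH(2) k by auto
    then have "1 < (n' choose e') + (n' choose Suc e')" by linarith
    then show ?thesis unfolding ne binomial_Suc_Suc .
  qed
  then have "1 + (\<Sum>h\<in>?K. n choose h) < (n choose e) + (\<Sum>h\<in>?K. n choose h)"
    by simp
  also have "\<dots> = (\<Sum>h\<in>insert e ?K. n choose h)"
    using fin eH by (subst sum.insert) auto
  also have "\<dots> \<le> (\<Sum>h\<in>H. n choose h)"
    using fin eH by (intro sum_mono2) auto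
  finally show ?thesis .
qed

lemma weighted_bound:
  assumes k: "2 \<le> k" "k \<le> n" and m: "n \<le> 2 * m + k" "2 * m + k \<le> n + 1"
    and interior: "\<And>a. 1 \<le> a \<Longrightarrow> a + k \<le> n \<Longrightarrow> n \<le> sum z {a..<a + k}"
    and first: "n \<le> 2 * sum z {..<k}"
    and last: "n \<le> 2 * sum z {Suc n - k..n}"
    and first_eq: "2 * sum z {..<k} = n \<Longrightarrow> z 0 = 0 \<and> z k = n"
  shows "n * S n k (int m) \<le> (\<Sum>i\<le>n. (n choose i) * z i) + (n - 1)"
proof -
  have n: "0 < n" using k by simp
  define H where "H = level_set n z"
  define A where "A = {\<theta> \<in> {..<n}. H \<theta> \<inter> {..<k} = {}}"
  define B where "B = {\<theta> \<in> {..<n}. H \<theta> \<inter> {Suc n - k..n} = {}}"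
  \<comment> \<open>Levels \<open>0\<close> and \<open>n\<close> have binomial coefficient 1, so
    each repair costs 1 and all repairs together cost at most
    \<open>card A + card B\<close>.\<close>
  define H' where "H' \<theta> = H \<theta> \<union> (if \<theta> \<in> A then {0} else {}) \<union> (if \<theta> \<in> B then {n} else {})" for \<theta>
  have H_le: "H \<theta> \<subseteq> {..n}" for \<theta> by (auto simp: H_def level_set_def)
  then have H'_le: "H' \<theta> \<subseteq> {..n}" for \<theta> by (auto simp: H'_def)
  have fin: "finite (H \<theta>)" for \<theta> using H_le finite_subset by blast
  have last_window: "{Suc n - k..n} = {Suc n - k..<Suc n - k + k}" using k by auto
  have "card A \<le> n - sum z {..<k}"
    using card_level_set_misses [OF n, of 0 k z] k by (simp add: A_def H_def lessThan_atLeast0)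
  \<comment> \<open>At most half of the residues lie in \<open>A\<close>, and likewise in
    \<open>B\<close>; hence only equality in the first window lets the repairs cost exactly
    \<open>n\<close>.\<close>
  then have A: "2 * card A \<le> n" "2 * sum z {..<k} \<noteq> n \<Longrightarrow> 2 * card A < n" "card A < n"
    using first n by linarith+
  have "card B \<le> n - sum z {Suc n - k..n}"
    using card_level_set_misses [OF n, of "Suc n - k" k z] k
    by (simp add: B_def H_def last_window)
  then have B: "2 * card B \<le> n" using last by linarith
  have hits: "hits_windows n k (H' \<theta>)" if "\<theta> < n" for \<theta>
    unfolding hits_windows_def
  proof (intro allI impI)
    fix a
    assume a: "a + k \<le> Suc n"
    consider "a = 0" | "a = Suc n - k" | "1 \<le> a" "a + k \<le> n" using a by linarith
    then show "H' \<theta> \<inter> {a..<a + k} \<noteq> {}"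
    proof cases
      case 1
      then show ?thesis using that k by (auto simp: H'_def A_def lessThan_atLeast0)
    next
      case 2
      then show ?thesis using that k unfolding 2 last_window [symmetric] by (auto simp: H'_def B_def)
    next
      case 3
      then have "card {\<theta> \<in> {..<n}. H \<theta> \<inter> {a..<a + k} = {}} = 0"
        using card_level_set_misses [OF n, of a k z] interior [of a] by (simp add: H_def)
      then show ?thesis using that by (auto simp: H'_def)
    qed
  qed
  then have bound: "S n k (int m) \<le> (\<Sum>h\<in>H' \<theta>. n choose h)" if "\<theta> < n" for \<theta>
    using that H'_le k m by (intro hits_windows_weight) auto
  \<comment> \<open>The extra unit pays for the difference between \<open>n\<close> and
    \<open>n - 1\<close> in the case of equality.\<close>
  have gain: "n * S n k (int m) + of_bool (2 * sum z {..<k} = n) \<le> (\<Sum>\<theta><n. \<Sum>h\<in>H' \<theta>. n choose h)"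
  proof (cases "2 * sum z {..<k} = n")
    case True
    have "\<not> {..<n} \<subseteq> A"
      using A(3) card_mono [of A "{..<n}"] by (auto simp: A_def)
    then obtain \<theta> where \<theta>: "\<theta> < n" "\<theta> \<notin> A" by blast
    \<comment> \<open>Since \<open>z 0 = 0\<close>, level \<open>0\<close> has an empty segment, and
      outside \<open>A\<close> it is not added as a repair; since \<open>z k = n\<close>, the
      segment of level \<open>k\<close> covers every residue.\<close>
    have "0 \<notin> H' \<theta>" using \<theta> n first_eq True by (auto simp: H'_def H_def level_set_def)
    moreover have "card {\<theta> \<in> {..<n}. H \<theta> \<inter> {k..<k + 1} = {}} = 0"
      using card_level_set_misses [OF n, of k 1 z] first_eq True k by (simp add: H_def)
    then have "k \<in> H' \<theta>" using \<theta> by (auto simp: H'_def)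
    ultimately have "S n k (int m) < (\<Sum>h\<in>H' \<theta>. n choose h)"
      using hits H'_le \<theta> k m by (intro weight_gain) auto
    then have "(\<Sum>\<theta><n. S n k (int m)) < (\<Sum>\<theta><n. \<Sum>h\<in>H' \<theta>. n choose h)"
      using \<theta> bound by (intro sum_strict_mono_ex1) auto
    then show ?thesis by simp
  next
    case False
    then show ?thesis using sum_mono [of "{..<n}", OF bound] by simp
  qed
  have H'_weight: "(\<Sum>h\<in>H' \<theta>. n choose h) \<le> (\<Sum>h\<in>H \<theta>. n choose h) + of_bool (\<theta> \<in> A) + of_bool (\<theta> \<in> B)" for \<theta>
  proof -
    have "(\<Sum>h\<in>X \<union> Y. n choose h) \<le> (\<Sum>h\<in>X. n choose h) + (\<Sum>h\<in>Y. n choose h)"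
      if "finite X" "finite Y" for X Y
      using sum.union_inter [OF that, of "\<lambda>h. n choose h"] by linarith
    from this [of "H \<theta> \<union> (if \<theta> \<in> A then {0} else {})" "if \<theta> \<in> B then {n} else {}"]
      this [of "H \<theta>" "if \<theta> \<in> A then {0} else {}"] fin
    show ?thesis by (auto simp: H'_def)
  qed
  have H_weight: "(\<Sum>\<theta><n. \<Sum>h\<in>H \<theta>. n choose h) \<le> (\<Sum>i\<le>n. (n choose i) * z i)"
  proof -
    have "(\<Sum>\<theta><n. \<Sum>h\<in>H \<theta>. n choose h) = (\<Sum>\<theta><n. \<Sum>h | h \<in> {..n} \<and> h \<in> H \<theta>. n choose h)"
      using H_le by (intro sum.cong) auto
    also have "\<dots> = (\<Sum>h\<le>n. \<Sum>\<theta> | \<theta> \<in> {..<n} \<and> h \<in> H \<theta>. n choose h)"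
      by (rule sum.swap_restrict) auto
    also have "\<dots> \<le> (\<Sum>i\<le>n. (n choose i) * z i)"
      using card_level_set [of n _ z] by (intro sum_mono) (simp add: H_def mult.commute)
    finally show ?thesis .
  qed
  have "(\<Sum>\<theta><n. \<Sum>h\<in>H' \<theta>. n choose h) \<le>
      (\<Sum>\<theta><n. (\<Sum>h\<in>H \<theta>. n choose h) + of_bool (\<theta> \<in> A) + of_bool (\<theta> \<in> B))"
    by (intro sum_mono H'_weight)
  also have "\<dots> = (\<Sum>\<theta><n. \<Sum>h\<in>H \<theta>. n choose h) + card A + card B"
  proof -
    have "(\<Sum>\<theta><n. of_bool (\<theta> \<in> X)) = card X" if "X \<subseteq> {..<n}" for X
      using that by (simp add: of_bool_def sum.If_cases Int_absorb1)
    moreover have "A \<subseteq> {..<n}" "B \<subseteq> {..<n}" by (auto simp: A_def B_def)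
    ultimately show ?thesis by (simp only: sum.distrib)
  qed
  finally have "n * S n k (int m) + of_bool (2 * sum z {..<k} = n) \<le>
      (\<Sum>i\<le>n. (n choose i) * z i) + card A + card B"
    using gain H_weight by linarith
  then show ?thesis using A B n by (cases "2 * sum z {..<k} = n") auto
qed

section \<open>Missing intervals\<close>

lemma periodic_sum_shift:
  fixes f :: "int \<Rightarrow> 'a::comm_monoid_add"
  assumes "0 < n" and "\<And>u. f (u + int n) = f u"
  shows "(\<Sum>u\<in>{0..<int n}. f (u - 1)) = (\<Sum>u\<in>{0..<int n}. f u)"
proof -
  have "(\<Sum>u\<in>{0..<int n}. f (u - 1)) = (\<Sum>u\<in>{-1..<int n - 1}. f u)"
    by (rule sum.reindex_bij_witness [of _ "\<lambda>u. u + 1" "\<lambda>u. u - 1"]) auto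
  also have "{-1..<int n - 1} = insert (-1) {0..<int n - 1}" using assms(1) by auto
  also have "(\<Sum>u\<in>insert (-1) {0..<int n - 1}. f u) = (\<Sum>u\<in>insert (int n - 1) {0..<int n - 1}. f u)"
    using assms(2) [of "-1"] by simp
  also have "insert (int n - 1) {0..<int n - 1} = {0..<int n}" using assms(1) by auto
  finally show ?thesis .
qed

lemma periodic_mod:
  fixes f :: "int \<Rightarrow> 'a"
  assumes "\<And>u. f (u + n) = f u"
  shows "f (u mod n) = f u"
proof -
  have "f (v + n * q) = f v" for v q
  proof (induction q rule: int_induct [where k = 0])
    case (step1 i)
    then show ?case using assms [of "v + n * i"] by (simp add: algebra_simps)
  next
    case (step2 i)
    then show ?case using assms [of "v + n * (i - 1)"] by (simp add: algebra_simps)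
  qed simp
  from this [of "u mod n" "u div n"] show ?thesis by simp
qed

text \<open>\<open>P t s\<close> stands for membership of the interval of size \<open>s\<close>
  starting at \<open>t\<close>, with \<open>t\<close> an integer so that neighbours need no
  wrap-around. In \<open>no_Y\<close> the chain starts at \<open>u\<close>, except that its smallest
  member may be shifted to \<open>u + 1\<close>; the bound \<open>a + k \<le> n\<close> keeps the
  two tops distinct. \<open>no_Y'\<close> is the dual, and there \<open>1 \<le> a\<close> keeps the
  two bottoms distinct.\<close>

locale interval_grid =
  fixes n k :: nat and P :: "int \<Rightarrow> nat \<Rightarrow> bool"
  assumes k3: "3 \<le> k" and kn: "k \<le> n"
    and periodic: "P (t + int n) s \<longleftrightarrow> P t s"
    and level0: "P t 0 \<longleftrightarrow> P u 0"
    and no_Y: "\<lbrakk>b \<in> {u, u + 1}; P b a; \<And>s. a < s \<Longrightarrow> s < a + k - 1 \<Longrightarrow> P u s; a + k \<le> n;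
      P u (a + k - 1); P (u - 1) (a + k - 1)\<rbrakk> \<Longrightarrow> False"
    and no_Y': "\<lbrakk>b \<in> {u, u - 1}; P b (a + k - 1); \<And>s. a < s \<Longrightarrow> s < a + k - 1 \<Longrightarrow> P u s;
      1 \<le> a; a + k \<le> Suc n; P u a; P (u + 1) a\<rbrakk> \<Longrightarrow> False"
begin

definition missing_level :: "nat \<Rightarrow> nat" where
  "missing_level s = card {u \<in> {0..<int n}. \<not> P u s}"

definition missing_column :: "nat \<Rightarrow> int \<Rightarrow> nat" where
  "missing_column a u = card {s \<in> {a..<a + k}. \<not> P u s}"

lemma n_pos: "0 < n"
  using k3 kn by simp

lemma missing_column_periodic: "missing_column a (u + int n) = missing_column a u"
  by (simp add: missing_column_def periodic)

lemma sum_missing: "(\<Sum>s\<in>{a..<a + k}. missing_level s) = (\<Sum>u\<in>{0..<int n}. missing_column a u)"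
proof -
  have "(\<Sum>s\<in>{a..<a + k}. missing_level s) = (\<Sum>s\<in>{a..<a + k}. \<Sum>u\<in>{0..<int n}. of_bool (\<not> P u s))"
    by (simp add: missing_level_def Int_def of_bool_def sum.If_cases)
  also have "\<dots> = (\<Sum>u\<in>{0..<int n}. \<Sum>s\<in>{a..<a + k}. of_bool (\<not> P u s))"
    by (rule sum.swap)
  also have "\<dots> = (\<Sum>u\<in>{0..<int n}. missing_column a u)"
    by (simp add: missing_column_def Int_def of_bool_def sum.If_cases)
  finally show ?thesis .
qed

lemma missing_column_eq_0: "missing_column a u = 0 \<longleftrightarrow> (\<forall>s\<in>{a..<a + k}. P u s)"
  by (auto simp: missing_column_def)

lemma missing_column_eq_1:
  assumes "missing_column a u = 1" and "s \<in> {a..<a + k}" and "\<not> P u s"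
  shows "\<forall>r\<in>{a..<a + k} - {s}. P u r"
proof -
  have "is_singleton {s \<in> {a..<a + k}. \<not> P u s}"
    using assms(1) by (simp add: missing_column_def is_singleton_altdef)
  then obtain x where "{s \<in> {a..<a + k}. \<not> P u s} = {x}" by (auto simp: is_singleton_def)
  then have "r \<in> {a..<a + k} \<and> \<not> P u r \<longleftrightarrow> r = x" for r by blast
  then show ?thesis using assms(2,3) by (metis DiffD1 DiffD2 singletonI)
qed

text \<open>Otherwise column \<open>u\<close>, together with the top interval at
  \<open>u - 1\<close> as second top, would form a copy of \<open>Y_k\<close>.\<close>

lemma full_column_top:
  assumes "missing_column a u = 0" and "a + k \<le> n"
  shows "\<not> P (u - 1) (a + k - 1)"
  using no_Y [of u u a] assms k3 by (auto simp: missing_column_eq_0)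

lemma full_column_bottom:
  assumes "missing_column a u = 0" and "1 \<le> a" and "a + k \<le> Suc n"
  shows "\<not> P (u + 1) a"
  using no_Y' [of u u a] assms k3 by (auto simp: missing_column_eq_0)

text \<open>
  An indebted column has a full column before it which is not yet compensated by a column missing
  two intervals. Such a debt must be settled before the next full column.
\<close>

inductive indebted :: "nat \<Rightarrow> int \<Rightarrow> bool" for a where
  full: "missing_column a u = 0 \<Longrightarrow> indebted a u"
| step: "indebted a (u - 1) \<Longrightarrow> missing_column a u = 1 \<Longrightarrow> \<not> P u a \<Longrightarrow> indebted a u"

lemma indebted_shift: "indebted a u \<Longrightarrow> c \<in> {int n, - int n} \<Longrightarrow> indebted a (u + c)"
proof (induction rule: indebted.induct)
  case (full u)
  then show ?case
    using missing_column_periodic [of a "u - int n"] missing_column_periodic [of a u]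
    by (auto intro!: indebted.full)
next
  case (step u)
  have "indebted a (u + c - 1)" using step by (simp add: algebra_simps)
  moreover have "missing_column a (u + c) = 1" "\<not> P (u + c) a"
    using step missing_column_periodic [of a "u - int n"] missing_column_periodic [of a u]
      periodic [of "u - int n" a] periodic [of u a]
    by auto
  ultimately show ?case by (rule indebted.step)
qed

lemma indebted_periodic: "indebted a (u + int n) \<longleftrightarrow> indebted a u"
  using indebted_shift [of a u "int n"] indebted_shift [of a "u + int n" "- int n"] by auto

lemma indebted_present:
  assumes "indebted a u" and "s \<in> {a<..<a + k}"
  shows "P u s"
  using assms(1)
proof cases
  case full
  then show ?thesis using assms(2) by (auto simp: missing_column_eq_0)
next
  case step
  then show ?thesis using missing_column_eq_1 [of a u a] assms(2) k3 by auto
qed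

text \<open>The top of an indebted column is present, so the next column cannot be full. If that
  column misses a single interval, it must be the bottom one, and the debt is carried on.\<close>

lemma indebted_next:
  assumes "1 \<le> a" and "a + k \<le> n" and "indebted a (u - 1)"
  shows "missing_column a u \<noteq> 0" and "missing_column a u = 1 \<Longrightarrow> \<not> P u a"
proof -
  have "P (u - 1) (a + k - 1)" using indebted_present assms(3) k3 by auto
  then show "missing_column a u \<noteq> 0" using full_column_top assms(2) by blast
next
  assume "missing_column a u = 1"
  show "\<not> P u a"
    using assms(3)
  proof cases
    case full
    then show ?thesis using full_column_bottom [of a "u - 1"] assms by auto
  next
    case step
    \<comment> \<open>Column \<open>u - 1\<close> lacks only its bottom interval. The bottom
      interval at \<open>u\<close>, if present, would take its place in a copy of \<open>Y_k\<close>
      whose second top lies in column \<open>u - 2\<close>.\<close>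
    then have "P (u - 1 - 1) (a + k - 1)" using indebted_present k3 by auto
    moreover have "P (u - 1) s" if "a < s" "s < a + k" for s
      using indebted_present [OF assms(3)] that by auto
    ultimately show ?thesis using no_Y [of u "u - 1" a] assms(2) k3 by auto
  qed
qed

text \<open>On average a column misses at least one interval: a full column opens a debt, a column
  missing one keeps any existing debt, and a column missing two or more can settle it. The debt
  terms cancel around the cycle.\<close>

lemma missing_window:
  assumes "1 \<le> a" and "a + k \<le> n"
  shows "n \<le> (\<Sum>s\<in>{a..<a + k}. missing_level s)"
proof -
  let ?D = "\<lambda>u. of_bool (indebted a u) :: int"
  have "?D (u - 1) + 1 \<le> int (missing_column a u) + ?D u" for u
  proof -
    consider "missing_column a u = 0" | "missing_column a u = 1" | "2 \<le> missing_column a u"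
      by linarith
    then show ?thesis
    proof cases
      case 1
      then show ?thesis using indebted_next(1) [OF assms, of u] indebted.full [OF 1] by auto
    next
      case 2
      then show ?thesis using indebted_next(2) [OF assms] indebted.step [of a u] by auto
    qed auto
  qed
  then have "(\<Sum>u\<in>{0..<int n}. ?D (u - 1) + 1) \<le>
      (\<Sum>u\<in>{0..<int n}. int (missing_column a u) + ?D u)"
    by (intro sum_mono)
  moreover have "(\<Sum>u\<in>{0..<int n}. ?D (u - 1)) = (\<Sum>u\<in>{0..<int n}. ?D u)"
    by (rule periodic_sum_shift [OF n_pos]) (simp add: indebted_periodic)
  ultimately have "int n \<le> (\<Sum>u\<in>{0..<int n}. int (missing_column a u))"
    by (simp add: sum.distrib)
  then show ?thesis
    unfolding sum_missing by (metis of_nat_le_iff of_nat_sum)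
qed

section \<open>The first and the last window of levels\<close>

lemma twice_sum_missing:
  "2 * (\<Sum>s\<in>{a..<a + k}. missing_level s) =
    (\<Sum>u\<in>{0..<int n}. missing_column a (u - 1) + missing_column a u)"
  using periodic_sum_shift [OF n_pos, of "missing_column a"]
  by (simp add: sum_missing sum.distrib missing_column_periodic)

text \<open>The debt argument needs both forbidden configurations, but each end window admits only
  one of them. What remains is that two neighbouring columns are never both full, which yields half
  of the bound.\<close>

lemma first_pair_missing: "1 \<le> missing_column 0 (u - 1) + missing_column 0 u"
  using full_column_top [of 0 u] kn k3 missing_column_eq_0 [of 0 "u - 1"] by fastforce

lemma missing_first: "n \<le> 2 * (\<Sum>s<k. missing_level s)"
  using twice_sum_missing [of 0] sum_mono [of "{0..<int n}" "\<lambda>_. 1::nat", OF first_pair_missing]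
  by (simp add: atLeast0LessThan)

lemma missing_last: "n \<le> 2 * (\<Sum>s\<in>{Suc n - k..n}. missing_level s)"
proof -
  have "1 \<le> missing_column (Suc n - k) (u - 1) + missing_column (Suc n - k) u" for u
    using full_column_bottom [of "Suc n - k" "u - 1"] kn k3
      missing_column_eq_0 [of "Suc n - k" "u"] by fastforce
  moreover have "{Suc n - k..n} = {Suc n - k..<Suc n - k + k}" using kn by auto
  ultimately show ?thesis
    using twice_sum_missing [of "Suc n - k"] sum_mono [of "{0..<int n}" "\<lambda>_. 1::nat"] by fastforce
qed

text \<open>Equality makes full columns alternate with columns that miss only their top. All levels
  below \<open>k - 1\<close> are then complete, and a present interval of size \<open>k\<close>
  would head a copy of \<open>Y'_k\<close>.\<close>

lemma missing_first_eq:
  assumes "2 * (\<Sum>s<k. missing_level s) = n"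
  shows "missing_level 0 = 0" and "missing_level k = n"
proof -
  let ?c = "missing_column 0"
  have "?c (u - 1) + ?c u = 1" if "u \<in> {0..<int n}" for u
  proof (rule ccontr)
    assume "?c (u - 1) + ?c u \<noteq> 1"
    then have "1 < ?c (u - 1) + ?c u"
      using first_pair_missing [of u] by linarith
    then have "(\<Sum>u\<in>{0..<int n}. 1) < (\<Sum>u\<in>{0..<int n}. ?c (u - 1) + ?c u)"
      using that first_pair_missing by (intro sum_strict_mono_ex1) auto
    then show False
      using twice_sum_missing [of 0] assms by (simp add: atLeast0LessThan)
  qed
  moreover have "?c (u mod int n - 1) + ?c (u mod int n) = ?c (u - 1) + ?c u" for u
    by (rule periodic_mod) (metis add_diff_eq diff_add_eq missing_column_periodic)
  ultimately have pair: "?c (u - 1) + ?c u = 1" for u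
    using n_pos by (metis atLeastLessThan_iff of_nat_0_less_iff pos_mod_bound pos_mod_sign)
  have P0: "P u 0" for u
  proof (rule ccontr)
    assume "\<not> P u 0"
    then have "?c t \<noteq> 0" for t using k3 level0 [of t u] by (auto simp: missing_column_eq_0)
    then have "1 \<le> ?c t" for t by (simp add: Suc_leI)
    from this [of 0] this [of "-1"] show False using pair [of 0] by simp
  qed
  have small: "P u s" if "s < k - 1" for u s
  proof (cases "?c u = 0")
    case True
    then show ?thesis using that by (auto simp: missing_column_eq_0)
  next
    case False
    then have "?c u = 1" "?c (u + 1) = 0" using pair [of "u + 1"] by auto
    then have "\<forall>r\<in>{0..<0 + k} - {k - 1}. P u r"
      using full_column_top [of 0 "u + 1"] kn k3 by (intro missing_column_eq_1) auto
    then show ?thesis using that by auto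
  qed
  have Pk: "\<not> P u k" for u
  proof
    assume "P u k"
    \<comment> \<open>The interval of size \<open>k\<close> at \<open>u\<close> contains those of
      size \<open>k - 1\<close> at \<open>u\<close> and \<open>u + 1\<close>. One of these two
      columns is full; it supplies the chain, and the singletons at \<open>v\<close> and
      \<open>v + 1\<close> are the two bottoms.\<close>
    define v where "v = (if ?c u = 0 then u else u + 1)"
    have "?c v = 0" using pair [of "u + 1"] by (auto simp: v_def)
    then have "\<And>s. s < k \<Longrightarrow> P v s" by (auto simp: missing_column_eq_0)
    moreover have "u \<in> {v, v - 1}" by (simp add: v_def)
    ultimately show False
      using no_Y' [of u v 1] small [of 1] \<open>P u k\<close> kn k3 by auto
  qed
  show "missing_level 0 = 0"
    by (simp add: missing_level_def P0)
  have "{u \<in> {0..<int n}. \<not> P u k} = {0..<int n}"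
    using Pk by blast
  then show "missing_level k = n"
    by (simp add: missing_level_def)
qed

end

section \<open>Arcs of a cyclic ordering\<close>

text \<open>Integer starting points make the left neighbour \<open>t - 1\<close> available without a
  case distinction and make arcs periodic in \<open>t\<close>.\<close>

definition arc :: "'a list \<Rightarrow> int \<Rightarrow> nat \<Rightarrow> 'a set" where
  "arc \<sigma> t s = (\<lambda>j. \<sigma> ! nat (j mod int (length \<sigma>))) ` {t..<t + int s}"

lemma arc_periodic: "arc \<sigma> (t + int (length \<sigma>)) s = arc \<sigma> t s"
proof -
  have "{t + int (length \<sigma>)..<t + int (length \<sigma>) + int s} = (\<lambda>j. j + int (length \<sigma>)) ` {t..<t + int s}"
    by (simp add: algebra_simps)
  then show ?thesis
    unfolding arc_def by (simp only: image_image mod_add_self2)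
qed

lemma arc_mod: "arc \<sigma> (t mod int (length \<sigma>)) s = arc \<sigma> t s"
  by (rule periodic_mod) (rule arc_periodic)

lemma arc_0: "arc \<sigma> t 0 = {}"
  by (simp add: arc_def)

lemma arc_mono: "t \<le> t' \<Longrightarrow> t' + int s' \<le> t + int s \<Longrightarrow> arc \<sigma> t' s' \<subseteq> arc \<sigma> t s"
  unfolding arc_def by (intro image_mono) auto

lemma cyclic_nth_eq_iff:
  assumes "distinct \<sigma>" and "\<sigma> \<noteq> []"
  shows "\<sigma> ! nat (i mod int (length \<sigma>)) = \<sigma> ! nat (j mod int (length \<sigma>)) \<longleftrightarrow>
    int (length \<sigma>) dvd i - j"
proof -
  have "nat (l mod int (length \<sigma>)) < length \<sigma>" for l
    using assms(2) by (simp add: nat_less_iff)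
  then have "\<sigma> ! nat (i mod int (length \<sigma>)) = \<sigma> ! nat (j mod int (length \<sigma>)) \<longleftrightarrow>
      nat (i mod int (length \<sigma>)) = nat (j mod int (length \<sigma>))"
    using assms(1) by (simp add: nth_eq_iff_index_eq)
  also have "\<dots> \<longleftrightarrow> i mod int (length \<sigma>) = j mod int (length \<sigma>)"
    using assms(2) by (simp add: eq_nat_nat_iff)
  finally show ?thesis by (simp add: mod_eq_dvd_iff)
qed

lemma card_arc:
  assumes "distinct \<sigma>" and "s \<le> length \<sigma>"
  shows "card (arc \<sigma> t s) = s"
proof (cases "\<sigma> = []")
  case False
  have "inj_on (\<lambda>j. \<sigma> ! nat (j mod int (length \<sigma>))) {t..<t + int s}"
  proof (rule linorder_inj_onI')
    fix i j
    assume "i \<in> {t..<t + int s}" "j \<in> {t..<t + int s}" "i < j"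
    then have "\<not> int (length \<sigma>) dvd j - i"
      using assms(2) by (intro zdvd_not_zless) auto
    then show "\<sigma> ! nat (i mod int (length \<sigma>)) \<noteq> \<sigma> ! nat (j mod int (length \<sigma>))"
      using cyclic_nth_eq_iff [OF assms(1) False] by metis
  qed
  then show ?thesis by (simp add: arc_def card_image)
qed (use assms in \<open>simp add: arc_0\<close>)

lemma mem_arc_iff:
  assumes "distinct \<sigma>" and "\<sigma> \<noteq> []"
  shows "\<sigma> ! nat (i mod int (length \<sigma>)) \<in> arc \<sigma> t s \<longleftrightarrow>
    (\<exists>j. t \<le> j \<and> j < t + int s \<and> int (length \<sigma>) dvd i - j)"
  unfolding arc_def image_iff cyclic_nth_eq_iff [OF assms] by auto

text \<open>The first point of the arc at \<open>t\<close> sits at some \<open>j\<close> in the arc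
  at \<open>u\<close>. If \<open>j\<close> were not \<open>u\<close>, the preceding point would
  belong to the common arc too, which is impossible for an arc starting at \<open>t\<close> that is
  not the whole cycle.\<close>

lemma arc_eqD:
  assumes "distinct \<sigma>" and "1 \<le> s" and "s < length \<sigma>" and eq: "arc \<sigma> t s = arc \<sigma> u s"
  shows "int (length \<sigma>) dvd t - u"
proof -
  have ne: "\<sigma> \<noteq> []" using assms(3) by auto
  note mem = mem_arc_iff [OF assms(1) ne]
  have "\<sigma> ! nat (t mod int (length \<sigma>)) \<in> arc \<sigma> t s"
    unfolding mem using assms(2) by (intro exI [of _ t]) auto
  then obtain j where j: "u \<le> j" "j < u + int s" "int (length \<sigma>) dvd t - j"
    unfolding eq mem by blast
  have "j = u"
  proof (rule ccontr)
    assume "j \<noteq> u"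
    then have "\<sigma> ! nat ((t - 1) mod int (length \<sigma>)) \<in> arc \<sigma> u s"
      unfolding mem using j by (intro exI [of _ "j - 1"]) auto
    then obtain i where i: "t \<le> i" "i < t + int s" "int (length \<sigma>) dvd t - 1 - i"
      unfolding eq [symmetric] mem by blast
    have "\<not> int (length \<sigma>) dvd i - (t - 1)"
      using i assms(3) by (intro zdvd_not_zless) auto
    with i(3) show False by (simp add: dvd_diff_commute)
  qed
  with j show ?thesis by simp
qed

lemma intervals_eq_arcs:
  assumes "\<sigma> \<noteq> []"
  shows "intervals \<sigma> = {arc \<sigma> t s | t s. t \<in> {0..<int (length \<sigma>)} \<and> s \<le> length \<sigma>}"
proof -
  have arc_nat: "{\<sigma> ! ((t + j) mod length \<sigma>) | j. j < s} = arc \<sigma> (int t) s" for t s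
  proof -
    have "{int t..<int t + int s} = (\<lambda>j. int (t + j)) ` {..<s}"
    proof (intro equalityI subsetI)
      fix x
      assume "x \<in> {int t..<int t + int s}"
      then have "x = int (t + nat (x - int t))" "nat (x - int t) < s" by auto
      then show "x \<in> (\<lambda>j. int (t + j)) ` {..<s}" by blast
    qed auto
    then have "arc \<sigma> (int t) s = (\<lambda>j. \<sigma> ! nat (int (t + j) mod int (length \<sigma>))) ` {..<s}"
      unfolding arc_def by (simp only: image_image)
    also have "\<dots> = (\<lambda>j. \<sigma> ! ((t + j) mod length \<sigma>)) ` {..<s}"
      by (simp only: flip: of_nat_mod) (simp only: nat_int)
    finally show ?thesis by blast
  qed
  have "\<exists>u\<in>{0..<int (length \<sigma>)}. arc \<sigma> (int t) s = arc \<sigma> u s" for t s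
    using arc_mod [of \<sigma> "int t" s] assms
    by (intro bexI [of _ "int t mod int (length \<sigma>)"]) auto
  moreover have "\<exists>v. arc \<sigma> u s = arc \<sigma> (int v) s" if "u \<in> {0..<int (length \<sigma>)}" for u s
    using that by (intro exI [of _ "nat u"]) auto
  ultimately show ?thesis
    unfolding intervals_def arc_nat by blast
qed

lemma interval_count_eq:
  assumes "distinct \<sigma>" and "1 \<le> i" and "i < length \<sigma>"
  shows "interval_count \<F> \<sigma> i = card {t \<in> {0..<int (length \<sigma>)}. arc \<sigma> t i \<in> \<F>}"
proof -
  have ne: "\<sigma> \<noteq> []"
    using assms(3) by auto
  have iff: "I \<in> intervals \<sigma> \<and> card I = i \<longleftrightarrow> (\<exists>t\<in>{0..<int (length \<sigma>)}. I = arc \<sigma> t i)" for I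
    unfolding intervals_eq_arcs [OF ne] mem_Collect_eq
    using card_arc [OF assms(1)] less_imp_le [OF assms(3)] by metis
  have "{I \<in> intervals \<sigma>. card I = i \<and> I \<in> \<F>} =
      {I. (\<exists>t\<in>{0..<int (length \<sigma>)}. I = arc \<sigma> t i) \<and> I \<in> \<F>}"
    by (simp only: iff conj_assoc [symmetric])
  also have "\<dots> = (\<lambda>t. arc \<sigma> t i) ` {t \<in> {0..<int (length \<sigma>)}. arc \<sigma> t i \<in> \<F>}"
    by auto
  finally have "{I \<in> intervals \<sigma>. card I = i \<and> I \<in> \<F>} =
      (\<lambda>t. arc \<sigma> t i) ` {t \<in> {0..<int (length \<sigma>)}. arc \<sigma> t i \<in> \<F>}" .
  moreover have "inj_on (\<lambda>t. arc \<sigma> t i) {t \<in> {0..<int (length \<sigma>)}. arc \<sigma> t i \<in> \<F>}"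
  proof (rule linorder_inj_onI')
    fix t u
    assume "t \<in> {t \<in> {0..<int (length \<sigma>)}. arc \<sigma> t i \<in> \<F>}"
      "u \<in> {t \<in> {0..<int (length \<sigma>)}. arc \<sigma> t i \<in> \<F>}" "t < u"
    then have "\<not> int (length \<sigma>) dvd u - t" by (intro zdvd_not_zless) auto
    then show "arc \<sigma> t i \<noteq> arc \<sigma> u i" using arc_eqD [OF assms(1-3)] by metis
  qed
  ultimately show ?thesis by (simp add: interval_count_def card_image)
qed

section \<open>Copies of \<open>Y_k\<close> and \<open>Y'_k\<close> among arcs\<close>

lemma arc_psubset:
  assumes "distinct \<sigma>" and "t' \<in> {t, t + 1}" and "s < length \<sigma>"
  shows "arc \<sigma> t' s \<subset> arc \<sigma> t (Suc s)"
proof -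
  have "arc \<sigma> t' s \<subseteq> arc \<sigma> t (Suc s)" using assms(2) by (intro arc_mono) auto
  moreover have "card (arc \<sigma> t' s) \<noteq> card (arc \<sigma> t (Suc s))" using assms by (simp add: card_arc)
  ultimately show ?thesis by (metis psubsetI)
qed

lemma arc_neq_shift:
  assumes "distinct \<sigma>" and "1 \<le> s" and "s < length \<sigma>"
  shows "arc \<sigma> t s \<noteq> arc \<sigma> (t + 1) s"
proof
  assume "arc \<sigma> t s = arc \<sigma> (t + 1) s"
  then have "int (length \<sigma>) dvd t - (t + 1)" using arc_eqD assms by metis
  then show False using assms(2,3) by simp
qed

lemma contains_Y_arcs:
  assumes \<sigma>: "distinct \<sigma>" and k: "3 \<le> k" and a: "a + k \<le> length \<sigma>"
    and b: "b \<in> {u, u + 1}" "arc \<sigma> b a \<in> \<F>"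
    and mid: "\<And>s. a < s \<Longrightarrow> s < a + k - 1 \<Longrightarrow> arc \<sigma> u s \<in> \<F>"
    and top: "arc \<sigma> u (a + k - 1) \<in> \<F>" "arc \<sigma> (u - 1) (a + k - 1) \<in> \<F>"
  shows "contains_Y k \<F>"
proof -
  \<comment> \<open>Only the smallest member starts at \<open>b\<close>; the sizes run from
    \<open>a\<close> to \<open>a + k - 2\<close>, one below the two tops.\<close>
  define G where "G i = arc \<sigma> (if i = 1 then b else u) (a + i - 1)" for i
  have card_G: "card (G i) = a + i - 1" if "i \<le> k" for i
    using that a by (simp add: G_def card_arc [OF \<sigma>])
  have card_top: "card (arc \<sigma> v (a + k - 1)) = a + k - 1" for v
    using a by (simp add: card_arc [OF \<sigma>])
  have "\<exists>i. i \<in> {1..k - 1} \<and> G i = X \<Longrightarrow> card X < a + k - 1" for X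
    using card_G k by fastforce
  then have fresh: "arc \<sigma> v (a + k - 1) \<notin> G ` {1..k - 1}" for v
    using card_top [of v] by fastforce
  have psubset_top: "G (k - 1) \<subset> arc \<sigma> v (a + k - 1)" if "v \<in> {u, u - 1}" for v
  proof -
    define s where "s = a + k - 2"
    \<comment> \<open>Because \<open>k\<close> is at least 3, the largest chain member is not the
      shifted one: it starts at \<open>u\<close> and so lies below both tops.\<close>
    have s: "a + k - 1 = Suc s" "a + (k - 1) - 1 = s" "k - 1 \<noteq> 1" "s < length \<sigma>"
      using k a by (auto simp: s_def)
    have "u \<in> {v, v + 1}" using that by auto
    from arc_psubset [OF \<sigma> this s(4)] show ?thesis
      unfolding G_def s(1,2) using s(3) by simp
  qed
  show ?thesis
    unfolding contains_Y_def
  proof (intro exI conjI ballI)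
    show "arc \<sigma> u (a + k - 1) \<in> \<F>" "arc \<sigma> (u - 1) (a + k - 1) \<in> \<F>" by (fact top)+
    show "G i \<in> \<F>" if "i \<in> {1..k - 1}" for i
      using that b mid [of "a + i - 1"] by (auto simp: G_def)
    show "arc \<sigma> u (a + k - 1) \<noteq> arc \<sigma> (u - 1) (a + k - 1)"
    proof -
      have "1 \<le> a + k - 1" "a + k - 1 < length \<sigma>" using a k by auto
      from arc_neq_shift [OF \<sigma> this, of "u - 1"] show ?thesis by simp
    qed
    show "inj_on G {1..k - 1}"
    proof (rule inj_onI)
      fix i j
      assume ij: "i \<in> {1..k - 1}" "j \<in> {1..k - 1}" "G i = G j"
      then have "i \<le> k" "j \<le> k" by auto
      then have "a + i - 1 = a + j - 1" using card_G ij(3) by metis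
      then show "i = j" using ij by auto
    qed
    show "G i \<subset> G (Suc i)" if "i \<in> {1..<k - 1}" for i
    proof -
      define s where "s = a + i - 1"
      have s: "a + Suc i - 1 = Suc s" "a + i - 1 = s" "Suc i \<noteq> 1" "s < length \<sigma>"
        using that a by (auto simp: s_def)
      have "(if i = 1 then b else u) \<in> {u, u + 1}" using b by auto
      from arc_psubset [OF \<sigma> this s(4)] show ?thesis
        unfolding G_def s(1,2) using s(3) by simp
    qed
    show "card (arc \<sigma> u (a + k - 1)) = card (arc \<sigma> (u - 1) (a + k - 1))"
      by (simp only: card_top)
    show "card (arc \<sigma> u (a + k - 1)) = card (G i) + (k - i)" if "i \<in> {1..k - 1}" for i
      using that card_G [of i] card_top [of u] by auto
  qed (use fresh psubset_top in auto)
qed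

lemma contains_Y'_arcs:
  assumes \<sigma>: "distinct \<sigma>" and k: "3 \<le> k" and a: "1 \<le> a" "a + k \<le> Suc (length \<sigma>)"
    and b: "b \<in> {u, u - 1}" "arc \<sigma> b (a + k - 1) \<in> \<F>"
    and mid: "\<And>s. a < s \<Longrightarrow> s < a + k - 1 \<Longrightarrow> arc \<sigma> u s \<in> \<F>"
    and bot: "arc \<sigma> u a \<in> \<F>" "arc \<sigma> (u + 1) a \<in> \<F>"
  shows "contains_Y' k \<F>"
proof -
  \<comment> \<open>The chain descends here, so the possibly shifted member \<open>G 1\<close> is
    the largest one, of size \<open>a + k - 1\<close>.\<close>
  define G where "G i = arc \<sigma> (if i = 1 then b else u) (a + k - i)" for i
  have card_G: "card (G i) = a + k - i" if "1 \<le> i" for i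
    using that a by (simp add: G_def card_arc [OF \<sigma>])
  have card_bot: "card (arc \<sigma> v a) = a" for v
    using a k by (simp add: card_arc [OF \<sigma>])
  have "\<exists>i. i \<in> {1..k - 1} \<and> G i = X \<Longrightarrow> a < card X" for X
    using card_G k by fastforce
  then have fresh: "arc \<sigma> v a \<notin> G ` {1..k - 1}" for v
    using card_bot [of v] by fastforce
  have psubset_bot: "arc \<sigma> v a \<subset> G (k - 1)" if "v \<in> {u, u + 1}" for v
    using arc_psubset [OF \<sigma>, of v u a] that k a by (auto simp: G_def)
  show ?thesis
    unfolding contains_Y'_def
  proof (intro exI conjI ballI)
    show "arc \<sigma> u a \<in> \<F>" "arc \<sigma> (u + 1) a \<in> \<F>" by (fact bot)+
    show "G i \<in> \<F>" if "i \<in> {1..k - 1}" for i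
      using that b mid [of "a + k - i"] by (auto simp: G_def)
    show "arc \<sigma> u a \<noteq> arc \<sigma> (u + 1) a"
      using arc_neq_shift [OF \<sigma>, of a u] a k by auto
    show "inj_on G {1..k - 1}"
    proof (rule inj_onI)
      fix i j
      assume "i \<in> {1..k - 1}" "j \<in> {1..k - 1}" "G i = G j"
      then show "i = j" using card_G [of i] card_G [of j] by auto
    qed
    show "G (Suc i) \<subset> G i" if "i \<in> {1..<k - 1}" for i
    proof -
      define s where "s = a + k - Suc i"
      have s: "a + k - i = Suc s" "a + k - Suc i = s" "Suc i \<noteq> 1" "s < length \<sigma>"
        using that a by (auto simp: s_def)
      have "u \<in> {if i = 1 then b else u, (if i = 1 then b else u) + 1}" using b by auto
      from arc_psubset [OF \<sigma> this s(4)] show ?thesis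
        unfolding G_def s(1,2) using s(3) by simp
    qed
    show "card (arc \<sigma> u a) = card (arc \<sigma> (u + 1) a)"
      by (simp only: card_bot)
    show "card (arc \<sigma> u a) + (k - i) = card (G i)" if "i \<in> {1..k - 1}" for i
      using that card_G [of i] card_bot [of u] by auto
  qed (use fresh psubset_bot in auto)
qed

section \<open>The inequality for a cyclic permutation\<close>

theorem theorem9:
  fixes n k :: nat and m :: int and \<F> :: "nat set set" and \<sigma> :: "nat list" and x :: "nat \<Rightarrow> nat"
  assumes "k \<ge> 3" and "n \<ge> k"
    and "m = \<lceil>(real n - real k) / 2\<rceil>"
    and "\<F> \<subseteq> Pow {1..n}"
    and "\<not> contains_Y k \<F>" and "\<not> contains_Y' k \<F>"
    and "\<sigma> \<in> permutations_of_set {1..n}"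
    and "\<And>i. i \<le> n \<Longrightarrow> x i = interval_count \<F> \<sigma> i"
  shows "int (card ({{}, {1..n}} \<inter> \<F>) * n) + (\<Sum>i = 1..n-1. int ((n choose i) * x i))
           \<le> int n * (2 ^ n - int (S n k m)) + int n - 1"
proof -
  have \<sigma>: "distinct \<sigma>" "set \<sigma> = {1..n}"
    using assms(7) by (auto simp: permutations_of_set_def)
  then have len: "length \<sigma> = n" using distinct_card by fastforce
  interpret interval_grid n k "\<lambda>t s. arc \<sigma> t s \<in> \<F>"
  proof
    fix t s
    show "arc \<sigma> (t + int n) s \<in> \<F> \<longleftrightarrow> arc \<sigma> t s \<in> \<F>"
      using arc_periodic [of \<sigma> t s] by (simp add: len)
  next
    fix b u a
    assume "b \<in> {u, u + 1}" "arc \<sigma> b a \<in> \<F>" "\<And>s. a < s \<Longrightarrow> s < a + k - 1 \<Longrightarrow> arc \<sigma> u s \<in> \<F>"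
      "a + k \<le> n" "arc \<sigma> u (a + k - 1) \<in> \<F>" "arc \<sigma> (u - 1) (a + k - 1) \<in> \<F>"
    then show False using contains_Y_arcs [OF \<sigma>(1) assms(1)] assms(5) by (metis len)
  next
    fix b u a
    assume "b \<in> {u, u - 1}" "arc \<sigma> b (a + k - 1) \<in> \<F>" "\<And>s. a < s \<Longrightarrow> s < a + k - 1 \<Longrightarrow> arc \<sigma> u s \<in> \<F>"
      "1 \<le> a" "a + k \<le> Suc n" "arc \<sigma> u a \<in> \<F>" "arc \<sigma> (u + 1) a \<in> \<F>"
    then show False using contains_Y'_arcs [OF \<sigma>(1) assms(1)] assms(6) by (metis len)
  qed (simp_all add: arc_0 assms(1,2))
  \<comment> \<open>The ceiling \<open>m\<close> as a quotient of natural numbers.\<close>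
  define q where "q = (n - k + 1) div 2"
  have q: "n \<le> 2 * q + k" "2 * q + k \<le> n + 1"
    using assms(2) by (auto simp: q_def)
  then have "real n \<le> 2 * real q + real k" "2 * real q + real k \<le> real n + 1"
    by linarith+
  then have mq: "m = int q"
    unfolding assms(3) by (intro ceiling_unique) auto
  let ?z = missing_level
  have z_add: "card {t \<in> {0..<int n}. arc \<sigma> t i \<in> \<F>} + ?z i = n" for i
  proof -
    have "card {t \<in> {0..<int n}. arc \<sigma> t i \<in> \<F>} + ?z i =
        card ({t \<in> {0..<int n}. arc \<sigma> t i \<in> \<F>} \<union> {t \<in> {0..<int n}. arc \<sigma> t i \<notin> \<F>})"
      unfolding missing_level_def by (rule card_Un_disjoint [symmetric]) (auto intro: finite_subset [of _ "{0..<int n}"])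
    also have "{t \<in> {0..<int n}. arc \<sigma> t i \<in> \<F>} \<union> {t \<in> {0..<int n}. arc \<sigma> t i \<notin> \<F>} = {0..<int n}"
      by auto
    finally show ?thesis by simp
  qed
  have x: "x i + ?z i = n" if "i \<in> {1..n - 1}" for i
    using z_add [of i] interval_count_eq [OF \<sigma>(1), of i \<F>] assms(8) [of i] that len
    by auto
  have arc_n: "arc \<sigma> t n = {1..n}" for t
  proof -
    have "arc \<sigma> t n \<subseteq> {1..n}"
      using n_pos \<sigma>(2) len by (auto simp: arc_def nat_less_iff simp flip: \<sigma>(2) intro!: nth_mem)
    then show ?thesis using card_arc [OF \<sigma>(1), of n t] len by (intro card_subset_eq) auto
  qed
  \<comment> \<open>The empty and the full arc are counted once for each of the \<open>n\<close>
    starting points, which matches the factor \<open>n\<close> on the end term of the claim.\<close>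
  have ends: "card ({{}, {1..n}} \<inter> \<F>) * n + ?z 0 + ?z n = 2 * n"
  proof -
    have "card ({{}, {1..n}} \<inter> \<F>) = of_bool ({} \<in> \<F>) + of_bool ({1..n} \<in> \<F>)"
      using n_pos by (auto simp: Int_insert_left)
    moreover have "{u. 0 \<le> u \<and> u < int n} = {0..<int n}" by auto
    then have "card {u. 0 \<le> u \<and> u < int n} = n" by simp
    then have "?z 0 = n * of_bool ({} \<notin> \<F>)" "?z n = n * of_bool ({1..n} \<notin> \<F>)"
      by (auto simp: missing_level_def arc_0 arc_n)
    ultimately show ?thesis by auto
  qed
  have split: "(\<Sum>i\<le>n. f i) = f 0 + f n + (\<Sum>i = 1..n - 1. f i)" for f :: "nat \<Rightarrow> nat"
  proof -
    have "{..n} = insert 0 (insert n {1..n - 1})" using n_pos by auto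
    then show ?thesis using n_pos by simp
  qed
  have "n * S n k m \<le> (\<Sum>i\<le>n. (n choose i) * ?z i) + (n - 1)"
    unfolding mq
  proof (rule weighted_bound)
    show "2 \<le> k" using assms(1) by simp
    show "2 * sum ?z {..<k} = n \<Longrightarrow> ?z 0 = 0 \<and> ?z k = n" using missing_first_eq by blast
  qed (fact assms(2) q missing_window missing_first missing_last)+
  \<comment> \<open>Present and missing arcs together have weight \<open>n * 2 ^ n\<close>, so the
    lower bound for the missing ones becomes the claimed upper bound.\<close>
  moreover have "card ({{}, {1..n}} \<inter> \<F>) * n + (\<Sum>i = 1..n - 1. (n choose i) * x i) +
      (\<Sum>i\<le>n. (n choose i) * ?z i) = n * 2 ^ n"
  proof -
    have "(\<Sum>i = 1..n - 1. (n choose i) * x i) + (\<Sum>i = 1..n - 1. (n choose i) * ?z i) =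
        (\<Sum>i = 1..n - 1. (n choose i) * n)"
      unfolding sum.distrib [symmetric] distrib_left [symmetric] using x by (intro sum.cong) auto
    moreover have "(\<Sum>i\<le>n. (n choose i) * n) = n * 2 ^ n"
      by (simp flip: sum_distrib_right add: choose_row_sum)
    ultimately show ?thesis using ends by (simp add: split)
  qed
  ultimately have "int (card ({{}, {1..n}} \<inter> \<F>) * n + (\<Sum>i = 1..n - 1. (n choose i) * x i)) +
      int (n * S n k m) \<le> int (n * 2 ^ n + (n - 1))"
    by linarith
  then show ?thesis using n_pos by (simp add: right_diff_distrib of_nat_diff)
qed

end
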